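(* Let $n\ge 1$ and let $BO(n)=\{(X,X^{-1}) : X\in GL(n)\}$, regarded as a Lie subgroup of the Lie group $\mathcal{G}(n)=GL(n)\times GL(n)$ with product $(X_1,X_2)\star(Y_1,Y_2)=(X_1Y_1,\,Y_2X_2)$. Identify the tangent space at the identity $T_{(I,I)}BO(n)=\{(X,-X) : X\in M(n)\}$ with $M(n)$ via $X\mapsto (X,-X)$. Then the (Lie group) exponential map of $BO(n)$ is given by $$\exp(X)=(e^{X},e^{-X}),\qquad X\in M(n).$$
   Context: $M(n)=\mathbb{R}^{n\times n}$ is the space of real $n\times n$ matrices, and $GL(n)$ is the group of invertible real $n\times n$ matrices. $I$ is the $n\times n$ identity matrix, and $e^{U}=I+U+\frac{1}{2!}U^2+\frac{1}{3!}U^3+\cdots$ is the matrix exponential. $\mathcal{G}(n)=GL(n)\times GL(n)$ carries the product manifold structure and the product $\star$ (note the reversed order in the second component), for which it is a Lie group with identity $(I,I)$. $BO(n)$ is a Lie subgroup of $\mathcal{G}(n)$: $(X,X^{-1})\star(Y,Y^{-1})=(XY,(XY)^{-1})$ and the inverse of $(X,X^{-1})$ is $(X^{-1},X)$. The exponential map of a Lie group $G$ sends $v\in T_eG$ to $\gamma(1)$, where $\gamma:\mathbb{R}\to G$ is the one-parameter subgroup with $\gamma'(0)=v$. *)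

theory Defs
  imports "HOL-Analysis.Analysis" "HOL-Algebra.Group"
begin

text \<open>
  The type class operations \<open>*\<close>, \<open>^\<close> and \<open>1\<close> on \<open>real^'n^'n\<close> are componentwise, so
  powers are formed with the matrix product \<open>**\<close> and the unit \<open>mat 1\<close>. For the same reason
  the library's \<open>exp\<close> cannot be used.
\<close>

definition mat_pow :: "real^'n^'n \<Rightarrow> nat \<Rightarrow> real^'n^'n" where
  "mat_pow U k = ((\<lambda>A. U ** A) ^^ k) (mat 1)"

definition mat_exp :: "real^'n^'n \<Rightarrow> real^'n^'n" where
  "mat_exp U = (\<Sum>k. (1 / fact k) *\<^sub>R mat_pow U k)"


text \<open>
  A \<open>C\<^sup>\<infinity>\<close> curve on an open set \<open>T\<close> of parameters: \<open>D k\<close> is the \<open>k\<close>-th derivative.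
\<close>

definition smooth_curve_on :: "real set \<Rightarrow> (real \<Rightarrow> 'a::real_normed_vector) \<Rightarrow> bool" where
  "smooth_curve_on T \<gamma> \<longleftrightarrow>
     (\<exists>D. D 0 = \<gamma> \<and> (\<forall>k. \<forall>t\<in>T. (D k has_vector_derivative D (Suc k) t) (at t)))"

text \<open>
  The manifolds here are embedded submanifolds \<open>S\<close> of a normed space. A curve into such an \<open>S\<close>
  is smooth iff it is smooth as a curve in the ambient space, and tangent vectors of \<open>S\<close> are
  vectors of the ambient space.
\<close>

definition tangent_space :: "'a::real_normed_vector set \<Rightarrow> 'a \<Rightarrow> 'a set" where
  "tangent_space S p =
     {v. \<exists>e>0. \<exists>\<gamma>. smooth_curve_on {-e<..<e} \<gamma> \<and> \<gamma> ` {-e<..<e} \<subseteq> S \<and> \<gamma> 0 = p \<and>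
                   (\<gamma> has_vector_derivative v) (at 0)}"

definition one_parameter_subgroup ::
  "('a::real_normed_vector) monoid \<Rightarrow> (real \<Rightarrow> 'a) \<Rightarrow> bool" where
  "one_parameter_subgroup G \<gamma> \<longleftrightarrow>
     smooth_curve_on UNIV \<gamma> \<and> range \<gamma> \<subseteq> carrier G \<and>
     (\<forall>s t. \<gamma> (s + t) = \<gamma> s \<otimes>\<^bsub>G\<^esub> \<gamma> t)"

text \<open>
  For \<open>v\<close> in the tangent space at the identity of a Lie group there is exactly one such
  one-parameter subgroup.
\<close>

definition lie_exp :: "('a::real_normed_vector) monoid \<Rightarrow> 'a \<Rightarrow> 'a" where
  "lie_exp G v =
     (THE \<gamma>. one_parameter_subgroup G \<gamma> \<and> (\<gamma> has_vector_derivative v) (at 0)) 1"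


definition GL_pair :: "((real^'n^'n) \<times> (real^'n^'n)) monoid" where
  "GL_pair =
     \<lparr>carrier = {A. invertible A} \<times> {A. invertible A},
      mult = (\<lambda>(X1, X2) (Y1, Y2). (X1 ** Y1, Y2 ** X2)),
      one = (mat 1, mat 1)\<rparr>"

text \<open>
  The graph of matrix inversion over the open set of invertible matrices, hence an embedded
  submanifold of the ambient space.
\<close>

definition BO_set :: "((real^'n^'n) \<times> (real^'n^'n)) set" where
  "BO_set = {(X, matrix_inv X) | X. invertible X}"

definition BO :: "((real^'n^'n) \<times> (real^'n^'n)) monoid" where
  "BO = GL_pair\<lparr>carrier := BO_set\<rparr>"


lemma matrix_inv_eqI:
  fixes A B :: "real^'n^'n"
  assumes "A ** B = mat 1"
  shows "matrix_inv A = B"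
proof -
  have BA: "B ** A = mat 1"
    using assms matrix_left_right_inverse by blast
  have "A ** matrix_inv A = mat 1 \<and> matrix_inv A ** A = mat 1"
    unfolding matrix_inv_def using assms BA
    by (intro someI[where P = "\<lambda>C. A ** C = mat 1 \<and> C ** A = mat 1"]) simp
  then show ?thesis
    by (metis BA matrix_mul_assoc matrix_mul_lid matrix_mul_rid)
qed

lemma BO_set_iff: "(X, Y) \<in> BO_set \<longleftrightarrow> X ** Y = mat 1"
  for X Y :: "real^'n^'n"
proof
  assume "(X, Y) \<in> BO_set"
  then have "invertible X" "Y = matrix_inv X"
    by (auto simp: BO_set_def)
  then show "X ** Y = mat 1"
    unfolding invertible_def using matrix_inv_eqI by metis
next
  assume "X ** Y = mat 1"
  then have "invertible X" "Y = matrix_inv X"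
    using matrix_left_right_inverse matrix_inv_eqI unfolding invertible_def by metis+
  then show "(X, Y) \<in> BO_set"
    by (auto simp: BO_set_def)
qed

lemma invertibleI: "A ** B = mat 1 \<Longrightarrow> invertible A"  "A ** B = mat 1 \<Longrightarrow> invertible B"
  for A B :: "real^'n^'n"
  by (meson invertible_def matrix_left_right_inverse)+

lemma group_GL_pair: "group (GL_pair :: ((real^'n^'n) \<times> (real^'n^'n)) monoid)"
proof (rule groupI)
  fix x :: "(real^'n^'n) \<times> (real^'n^'n)"
  assume "x \<in> carrier GL_pair"
  then obtain X1 X2 where x: "x = (X1, X2)" "invertible X1" "invertible X2"
    by (auto simp: GL_pair_def)
  then obtain Y1 Y2 where Y: "Y1 ** X1 = mat 1" "X2 ** Y2 = mat 1"
    unfolding invertible_def by blast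
  then show "\<exists>y\<in>carrier GL_pair. y \<otimes>\<^bsub>GL_pair\<^esub> x = \<one>\<^bsub>GL_pair\<^esub>"
    by (intro bexI[of _ "(Y1, Y2)"]) (auto simp: GL_pair_def x intro: invertibleI)
qed (auto simp: GL_pair_def matrix_mul_assoc invertible_mult intro: invertibleI[of "mat 1" "mat 1"])

lemma subgroup_BO_set: "subgroup (BO_set :: ((real^'n^'n) \<times> (real^'n^'n)) set) GL_pair"
proof -
  interpret group "GL_pair :: ((real^'n^'n) \<times> (real^'n^'n)) monoid"
    by (rule group_GL_pair)
  show ?thesis
  proof (rule subgroupI)
    show "BO_set \<subseteq> carrier GL_pair"
      by (auto simp: BO_set_iff GL_pair_def intro: invertibleI)
    show "BO_set \<noteq> ({} :: ((real^'n^'n) \<times> (real^'n^'n)) set)"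
      using BO_set_iff[of "mat 1" "mat 1"] by auto
  next
    fix a :: "(real^'n^'n) \<times> (real^'n^'n)"
    assume a: "a \<in> BO_set"
    obtain X Y where XY: "a = (X, Y)" "X ** Y = mat 1" "Y ** X = mat 1"
      using a by (cases a) (auto simp: BO_set_iff matrix_left_right_inverse)
    have "inv\<^bsub>GL_pair\<^esub> a = (Y, X)"
      by (rule inv_equality)
        (auto simp: XY GL_pair_def intro: invertibleI[OF XY(2)] invertibleI[OF XY(3)])
    then show "inv\<^bsub>GL_pair\<^esub> a \<in> BO_set"
      by (simp add: BO_set_iff XY)
  next
    fix a b :: "(real^'n^'n) \<times> (real^'n^'n)"
    assume ab: "a \<in> BO_set" "b \<in> BO_set"
    obtain X Y X' Y' where *: "a = (X, Y)" "b = (X', Y')"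
      by (cases a, cases b)
    with ab have 1: "X ** Y = mat 1" "X' ** Y' = mat 1"
      by (simp_all add: BO_set_iff)
    have "(X ** X') ** (Y' ** Y) = X ** ((X' ** Y') ** Y)"
      by (simp add: matrix_mul_assoc)
    then show "a \<otimes>\<^bsub>GL_pair\<^esub> b \<in> BO_set"
      by (simp add: 1 * GL_pair_def BO_set_iff)
  qed
qed

lemma closed_BO_set: "closed (BO_set :: ((real^'n^'n) \<times> (real^'n^'n)) set)"
proof -
  have eq: "BO_set = (\<lambda>p :: (real^'n^'n) \<times> (real^'n^'n). fst p ** snd p) -` {mat 1}"
    by (auto simp: BO_set_iff)
  have "continuous_on UNIV (\<lambda>p :: (real^'n^'n) \<times> (real^'n^'n). fst p ** snd p)"
    unfolding matrix_matrix_mult_def by (intro continuous_intros)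
  then show ?thesis
    unfolding eq by (intro closed_vimage) auto
qed

lemma group_BO: "group BO"
  unfolding BO_def by (rule subgroup.subgroup_is_group[OF subgroup_BO_set group_GL_pair])

end

theory Submission
  imports Defs
begin

text \<open>
  The curve \<open>t \<mapsto> e\<^bsup>tX\<^esup>\<close> is a power series in \<open>t\<close>, so term-by-term differentiation shows that it
  solves \<open>F' = X F\<close>. Solutions of this equation are determined by \<open>F 0\<close>, because
  \<open>e\<^bsup>-tX\<^esup> F t\<close> has derivative zero. This single uniqueness principle gives both the group law
  \<open>e\<^bsup>(s+t)X\<^esup> = e\<^bsup>sX\<^esup> e\<^bsup>tX\<^esup>\<close> and the uniqueness of one-parameter subgroups of \<open>BO\<close>: the components
  of such a subgroup with initial velocity \<open>(X, -X)\<close> solve the equations for \<open>X\<close> and \<open>-X\<close>.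
  The tangent space is found by differentiating \<open>A t ** B t = mat 1\<close> at \<open>0\<close>.
\<close>

lemma has_vector_derivative_powser:
  fixes a :: "nat \<Rightarrow> 'a::euclidean_space"
  assumes "\<And>t. summable (\<lambda>k. t ^ k *\<^sub>R a k)"
  shows "((\<lambda>t. \<Sum>k. t ^ k *\<^sub>R a k) has_vector_derivative
          (\<Sum>k. t ^ k *\<^sub>R (real (Suc k) *\<^sub>R a (Suc k)))) (at t)"
proof -
  have component: "((\<lambda>t. (\<Sum>k. t ^ k *\<^sub>R a k) \<bullet> b) has_field_derivative
      (\<Sum>k. diffs (\<lambda>k. a k \<bullet> b) k * t ^ k)) (at t)" for b t
  proof -
    have sums: "(\<lambda>k. (a k \<bullet> b) * t ^ k) sums ((\<Sum>k. t ^ k *\<^sub>R a k) \<bullet> b)" for t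
      using bounded_linear.sums[OF bounded_linear_inner_left summable_sums[OF assms], of t b]
      by (simp add: mult.commute)
    then have "(\<lambda>t. (\<Sum>k. t ^ k *\<^sub>R a k) \<bullet> b) = (\<lambda>t. \<Sum>k. (a k \<bullet> b) * t ^ k)"
      by (auto simp: sums_iff)
    then show ?thesis
      using termdiffs_strong_converges_everywhere[of "\<lambda>k. a k \<bullet> b" t] sums
      by (auto simp: sums_iff)
  qed
  have summable_diffs: "summable (\<lambda>k. diffs (\<lambda>k. a k \<bullet> b) k * t ^ k)" for b
  proof (rule termdiff_converges_all)
    show "summable (\<lambda>k. (a k \<bullet> b) * t ^ k)" for t
      using bounded_linear.summable[OF bounded_linear_inner_left assms, of t b]
      by (simp add: mult.commute)
  qed
  define d where "d = (\<Sum>b\<in>Basis. (\<Sum>k. diffs (\<lambda>k. a k \<bullet> b) k * t ^ k) *\<^sub>R b)"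
  have "(\<lambda>k. \<Sum>b\<in>Basis. (diffs (\<lambda>k. a k \<bullet> b) k * t ^ k) *\<^sub>R b) sums d"
    unfolding d_def
    by (intro sums_sum sums_scaleR_left summable_sums summable_diffs)
  also have "(\<lambda>k. \<Sum>b\<in>Basis. (diffs (\<lambda>k. a k \<bullet> b) k * t ^ k) *\<^sub>R b) =
      (\<lambda>k. \<Sum>b\<in>Basis. ((t ^ k *\<^sub>R (real (Suc k) *\<^sub>R a (Suc k))) \<bullet> b) *\<^sub>R b)"
    by (simp add: diffs_def mult_ac)
  also have "\<dots> = (\<lambda>k. t ^ k *\<^sub>R (real (Suc k) *\<^sub>R a (Suc k)))"
    by (simp only: euclidean_representation)
  finally have d: "(\<Sum>k. t ^ k *\<^sub>R (real (Suc k) *\<^sub>R a (Suc k))) = d"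
    by (simp add: sums_iff)
  have "((\<lambda>t. (\<Sum>k. t ^ k *\<^sub>R a k) \<bullet> b) has_derivative (\<lambda>h. (h *\<^sub>R d) \<bullet> b)) (at t)"
    if "b \<in> Basis" for b
  proof -
    have "d \<bullet> b = (\<Sum>k. diffs (\<lambda>k. a k \<bullet> b) k * t ^ k)"
      using that by (simp add: d_def)
    with component[of b t] show ?thesis
      by (simp add: has_field_derivative_def mult_commute_abs)
  qed
  then show ?thesis
    unfolding d has_vector_derivative_def
    by (subst has_derivative_componentwise_within) blast
qed

lemma bounded_bilinear_matrix_mult:
  "bounded_bilinear ((**) :: real^'n^'m \<Rightarrow> real^'p^'n \<Rightarrow> real^'p^'m)"
proof -
  have "bilinear ((**) :: real^'n^'m \<Rightarrow> real^'p^'n \<Rightarrow> real^'p^'m)"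
    unfolding bilinear_def
    by (auto intro!: linearI simp: vec_eq_iff matrix_matrix_mult_def algebra_simps
        sum.distrib sum_distrib_left)
  then show ?thesis
    by (simp add: bilinear_conv_bounded_bilinear)
qed

lemmas matrix_mult_minus_left = bounded_bilinear.minus_left[OF bounded_bilinear_matrix_mult]
lemmas matrix_mult_minus_right = bounded_bilinear.minus_right[OF bounded_bilinear_matrix_mult]
lemmas matrix_mult_scaleR_left = bounded_bilinear.scaleR_left[OF bounded_bilinear_matrix_mult]
lemmas matrix_mult_scaleR_right = bounded_bilinear.scaleR_right[OF bounded_bilinear_matrix_mult]
lemmas has_vector_derivative_matrix_mult =
  bounded_bilinear.has_vector_derivative[OF bounded_bilinear_matrix_mult]
lemmas bounded_linear_matrix_mult_right =
  bounded_bilinear.bounded_linear_right[OF bounded_bilinear_matrix_mult]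
lemmas bounded_linear_matrix_mult_left =
  bounded_bilinear.bounded_linear_left[OF bounded_bilinear_matrix_mult]

lemma mat_pow_0 [simp]: "mat_pow U 0 = mat 1"
  by (simp add: mat_pow_def)

lemma mat_pow_Suc [simp]: "mat_pow U (Suc k) = U ** mat_pow U k"
  by (simp add: mat_pow_def)

lemma mat_pow_commutes: "mat_pow U k ** U = U ** mat_pow U k"
  by (induction k) (simp_all add: matrix_mul_assoc[symmetric])

lemma mat_pow_scaleR: "mat_pow (t *\<^sub>R U) k = t ^ k *\<^sub>R mat_pow U k"
  by (induction k) (simp_all add: matrix_mult_scaleR_left matrix_mult_scaleR_right)

lemma summable_mat_exp:
  fixes U :: "real^'n^'n"
  shows "summable (\<lambda>k. (1 / fact k) *\<^sub>R mat_pow U k)"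
proof -
  obtain K where "K > 0" and K: "\<And>(A :: real^'n^'n) (B :: real^'n^'n). norm (A ** B) \<le> norm A * norm B * K"
    using bounded_bilinear.pos_bounded[OF bounded_bilinear_matrix_mult] by blast
  have bound: "norm (mat_pow U k) \<le> norm (mat 1 :: real^'n^'n) * (norm U * K) ^ k" for k
  proof (induction k)
    case (Suc k)
    have "norm (mat_pow U (Suc k)) \<le> norm U * norm (mat_pow U k) * K"
      unfolding mat_pow_Suc by (rule K)
    also have "\<dots> \<le> norm U * (norm (mat 1 :: real^'n^'n) * (norm U * K) ^ k) * K"
      using Suc \<open>K > 0\<close> by (intro mult_right_mono mult_left_mono) auto
    finally show ?case
      by (simp add: mult_ac)
  qed simp
  show ?thesis
  proof (rule summable_comparison_test')
    show "summable (\<lambda>k. norm (mat 1 :: real^'n^'n) * (inverse (fact k) * (norm U * K) ^ k))"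
      by (intro summable_mult summable_exp)
    show "norm ((1 / fact k) *\<^sub>R mat_pow U k) \<le>
        norm (mat 1 :: real^'n^'n) * (inverse (fact k) * (norm U * K) ^ k)" for k
      using mult_left_mono[OF bound[of k], of "inverse (fact k)"] by (simp add: field_simps)
  qed
qed

lemma mat_exp_0 [simp]: "mat_exp (0 :: real^'n^'n) = mat 1"
proof -
  have "(1 / fact k) *\<^sub>R mat_pow (0 :: real^'n^'n) k = (if k = 0 then mat 1 else 0)" for k
    using mat_pow_scaleR[of 0 "0 :: real^'n^'n" k] by (cases k) auto
  then have "(\<lambda>k. (1 / fact k) *\<^sub>R mat_pow (0 :: real^'n^'n) k) sums mat 1"
    using sums_single[of 0 "\<lambda>_. mat 1 :: real^'n^'n"] by (simp only:)
  then show ?thesis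
    by (simp add: mat_exp_def sums_iff)
qed

lemma mat_exp_commutes: "mat_exp (t *\<^sub>R U) ** U = U ** mat_exp (t *\<^sub>R U)"
proof -
  have "((1 / fact k) *\<^sub>R mat_pow (t *\<^sub>R U) k) ** U = U ** ((1 / fact k) *\<^sub>R mat_pow (t *\<^sub>R U) k)" for k
    by (simp add: mat_pow_scaleR matrix_mult_scaleR_left matrix_mult_scaleR_right mat_pow_commutes)
  then show ?thesis
    unfolding mat_exp_def
      bounded_linear.suminf[OF bounded_linear_matrix_mult_right summable_mat_exp]
      bounded_linear.suminf[OF bounded_linear_matrix_mult_left summable_mat_exp]
    by (simp only:)
qed

lemma mat_exp_has_vector_derivative:
  "((\<lambda>t. mat_exp (t *\<^sub>R U)) has_vector_derivative U ** mat_exp (t *\<^sub>R U)) (at t)"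
proof -
  define a where "a k = (1 / fact k) *\<^sub>R mat_pow U k" for k
  have a: "t ^ k *\<^sub>R a k = (1 / fact k) *\<^sub>R mat_pow (t *\<^sub>R U) k" for t k
    by (simp add: a_def mat_pow_scaleR)
  have "t ^ k *\<^sub>R (real (Suc k) *\<^sub>R a (Suc k)) = U ** ((1 / fact k) *\<^sub>R mat_pow (t *\<^sub>R U) k)" for k
    by (simp add: a_def mat_pow_scaleR matrix_mult_scaleR_right field_simps del: of_nat_Suc)
  then have "(\<Sum>k. t ^ k *\<^sub>R (real (Suc k) *\<^sub>R a (Suc k))) = U ** mat_exp (t *\<^sub>R U)"
    unfolding mat_exp_def
    by (simp only: bounded_linear.suminf[OF bounded_linear_matrix_mult_right summable_mat_exp])
  with has_vector_derivative_powser[of a t] show ?thesis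
    by (simp only: a summable_mat_exp mat_exp_def[symmetric])
qed

lemma matrix_ode_unique:
  fixes F :: "real \<Rightarrow> real^'n^'n"
  assumes F: "\<And>t. (F has_vector_derivative U ** F t) (at t)"
  shows "F t = mat_exp (t *\<^sub>R U) ** F 0"
proof -
  have first_integral: "mat_exp (t *\<^sub>R - U) ** G t = G 0"
    if G: "\<And>t. (G has_vector_derivative U ** G t) (at t)"
    for G :: "real \<Rightarrow> real^'n^'n" and t
  proof -
    have "((\<lambda>t. mat_exp (t *\<^sub>R - U) ** G t) has_vector_derivative 0) (at t)" for t
    proof -
      have "mat_exp (t *\<^sub>R - U) ** U = U ** mat_exp (t *\<^sub>R - U)"
        using mat_exp_commutes[of t "- U"]
        by (simp only: matrix_mult_minus_left matrix_mult_minus_right neg_equal_iff_equal)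
      then have "mat_exp (t *\<^sub>R - U) ** (U ** G t) + ((- U) ** mat_exp (t *\<^sub>R - U)) ** G t = 0"
        by (simp only: matrix_mult_minus_left matrix_mul_assoc add.right_inverse)
      with has_vector_derivative_matrix_mult[OF mat_exp_has_vector_derivative[of "- U" t] G[of t]]
      show ?thesis
        by (simp only:)
    qed
    then obtain c where "\<And>t. mat_exp (t *\<^sub>R - U) ** G t = c"
      using has_vector_derivative_zero_constant[of UNIV "\<lambda>t. mat_exp (t *\<^sub>R - U) ** G t"] by auto
    from this[of t] this[of 0] show ?thesis
      by simp
  qed
  have "mat_exp (t *\<^sub>R - U) ** mat_exp (t *\<^sub>R U) = mat 1"
    using first_integral[OF mat_exp_has_vector_derivative] by simp
  then have "mat_exp (t *\<^sub>R U) ** mat_exp (t *\<^sub>R - U) = mat 1"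
    using matrix_left_right_inverse by blast
  then have "F t = mat_exp (t *\<^sub>R U) ** (mat_exp (t *\<^sub>R - U) ** F t)"
    by (simp add: matrix_mul_assoc)
  then show ?thesis
    by (simp only: first_integral[OF F])
qed

lemma has_vector_derivative_shift:
  assumes "(F has_vector_derivative D) (at (s + t))"
  shows "((\<lambda>t. F (s + t)) has_vector_derivative D) (at t)"
proof -
  have "((\<lambda>t. s + t) has_vector_derivative 0 + 1) (at t)"
    by (intro has_vector_derivative_add has_vector_derivative_const has_vector_derivative_id)
  from vector_diff_chain_at[OF this assms] show ?thesis
    by (simp add: o_def)
qed

lemma mat_exp_add_scaleR: "mat_exp ((s + t) *\<^sub>R U) = mat_exp (s *\<^sub>R U) ** mat_exp (t *\<^sub>R U)"
proof -
  have "mat_exp ((t + s) *\<^sub>R U) = mat_exp (s *\<^sub>R U) ** mat_exp ((t + 0) *\<^sub>R U)"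
    by (rule matrix_ode_unique[where F = "\<lambda>s. mat_exp ((t + s) *\<^sub>R U)"])
      (rule has_vector_derivative_shift[OF mat_exp_has_vector_derivative])
  then show ?thesis
    by (simp add: add.commute)
qed

lemma mat_exp_mult_minus: "mat_exp U ** mat_exp (- U) = mat 1"
  using mat_exp_add_scaleR[of 1 "- 1" U] by simp

lemma mat_pow_mat_exp_has_vector_derivative:
  "((\<lambda>t. mat_pow U k ** mat_exp (t *\<^sub>R U)) has_vector_derivative
    mat_pow U (Suc k) ** mat_exp (t *\<^sub>R U)) (at t)"
  using bounded_linear.has_vector_derivative[OF bounded_linear_matrix_mult_right
      mat_exp_has_vector_derivative, of "mat_pow U k" U t]
  by (simp add: matrix_mul_assoc mat_pow_commutes)

lemma matrix_one_parameter_subgroup_unique: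
  fixes A :: "real \<Rightarrow> real^'n^'n"
  assumes hom: "\<And>s t. A (s + t) = A s ** A t"
    and "invertible (A 0)"
    and deriv: "(A has_vector_derivative U) (at 0)"
  shows "A t = mat_exp (t *\<^sub>R U)"
proof -
  have "A 0 ** A 0 = A 0"
    using hom[of 0 0] by simp
  with \<open>invertible (A 0)\<close> have "A 0 = mat 1"
    unfolding invertible_def by (metis matrix_mul_assoc matrix_mul_lid)
  moreover have "(A has_vector_derivative U ** A t) (at t)" for t
  proof -
    have "((\<lambda>s. A s ** A t) has_vector_derivative U ** A t) (at 0)"
      using bounded_linear.has_vector_derivative[OF bounded_linear_matrix_mult_left deriv] .
    then have "((\<lambda>s. A (s + t)) has_vector_derivative U ** A t) (at (- t + t))"
      by (simp add: hom)
    then show ?thesis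
      by (drule_tac has_vector_derivative_shift) simp
  qed
  ultimately show ?thesis
    using matrix_ode_unique[of A U t] by simp
qed

lemma carrier_BO: "carrier BO = BO_set"
  by (simp add: BO_def)

lemma mult_BO: "(A, B) \<otimes>\<^bsub>BO\<^esub> (C, D) = (A ** C, D ** B)"
  by (simp add: BO_def GL_pair_def)

lemma one_BO: "\<one>\<^bsub>BO\<^esub> = (mat 1, mat 1)"
  by (simp add: BO_def GL_pair_def)

definition BO_curve :: "real^'n^'n \<Rightarrow> real \<Rightarrow> (real^'n^'n) \<times> (real^'n^'n)" where
  "BO_curve X t = (mat_exp (t *\<^sub>R X), mat_exp (t *\<^sub>R - X))"

lemma BO_curve_0: "BO_curve X 0 = \<one>\<^bsub>BO\<^esub>"
  by (simp add: BO_curve_def one_BO)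

lemma smooth_BO_curve: "smooth_curve_on T (BO_curve X)"
  unfolding smooth_curve_on_def
proof (intro exI conjI allI ballI)
  let ?D = "\<lambda>k t. (mat_pow X k ** mat_exp (t *\<^sub>R X), mat_pow (- X) k ** mat_exp (t *\<^sub>R - X))"
  show "?D 0 = BO_curve X"
    by (auto simp: BO_curve_def)
  show "(?D k has_vector_derivative ?D (Suc k) t) (at t)" for k t
    by (intro has_vector_derivative_Pair mat_pow_mat_exp_has_vector_derivative)
qed

lemma BO_curve_has_vector_derivative: "(BO_curve X has_vector_derivative (X, - X)) (at 0)"
  using has_vector_derivative_Pair[OF mat_exp_has_vector_derivative[of X 0]
      mat_exp_has_vector_derivative[of "- X" 0]]
  by (simp add: BO_curve_def[abs_def])

lemma BO_curve_in_carrier: "BO_curve X t \<in> carrier BO"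
  using mat_exp_mult_minus[of "t *\<^sub>R X"] by (simp add: BO_curve_def carrier_BO BO_set_iff)

lemma one_parameter_subgroup_BO_curve: "one_parameter_subgroup BO (BO_curve X)"
proof -
  have "BO_curve X (s + t) = BO_curve X s \<otimes>\<^bsub>BO\<^esub> BO_curve X t" for s t
    using mat_exp_add_scaleR[of s t X] mat_exp_add_scaleR[of t s "- X"]
    by (simp only: BO_curve_def mult_BO add.commute[of t s])
  then show ?thesis
    unfolding one_parameter_subgroup_def using smooth_BO_curve BO_curve_in_carrier by blast
qed

lemma one_parameter_subgroup_BO_unique:
  fixes X :: "real^'n^'n"
  assumes "one_parameter_subgroup BO \<gamma>" and deriv: "(\<gamma> has_vector_derivative (X, - X)) (at 0)"
  shows "\<gamma> = BO_curve X"
proof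
  fix t
  define A where "A s = fst (\<gamma> s)" for s
  define B where "B s = snd (\<gamma> s)" for s
  have \<gamma>: "\<gamma> s = (A s, B s)" for s
    by (simp add: A_def B_def)
  have hom: "A (s + t) = A s ** A t" "B (s + t) = B t ** B s" for s t
    using assms(1) by (simp_all add: one_parameter_subgroup_def \<gamma> mult_BO)
  have "\<gamma> 0 \<in> BO_set"
    using assms(1) by (auto simp: one_parameter_subgroup_def carrier_BO)
  then have inv: "invertible (A 0)" "invertible (B 0)"
    by (auto simp: \<gamma> BO_set_iff intro: invertibleI)
  have "(A has_vector_derivative X) (at 0)" "(B has_vector_derivative - X) (at 0)"
    using bounded_linear.has_vector_derivative[OF bounded_linear_fst deriv]
      bounded_linear.has_vector_derivative[OF bounded_linear_snd deriv]
    by (simp_all add: A_def[abs_def] B_def[abs_def])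
  moreover have "B (s + t) = B s ** B t" for s t
    using hom(2)[of t s] by (simp add: add.commute)
  ultimately have "A t = mat_exp (t *\<^sub>R X)" "B t = mat_exp (t *\<^sub>R - X)"
    using matrix_one_parameter_subgroup_unique hom(1) inv by blast+
  then show "\<gamma> t = BO_curve X t"
    by (simp add: \<gamma> BO_curve_def)
qed

lemma lie_exp_BO: "lie_exp BO (X, - X) = (mat_exp X, mat_exp (- X))"
proof -
  have "(THE \<gamma>. one_parameter_subgroup BO \<gamma> \<and> (\<gamma> has_vector_derivative (X, - X)) (at 0)) =
      BO_curve X"
    by (rule the_equality)
      (auto simp: one_parameter_subgroup_BO_curve BO_curve_has_vector_derivative
        intro: one_parameter_subgroup_BO_unique)
  then show ?thesis
    by (simp add: lie_exp_def BO_curve_def)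
qed

lemma tangent_space_BO: "tangent_space (carrier BO) \<one>\<^bsub>BO\<^esub> = {(X, - X) | X :: real^'n^'n. True}"
proof (intro equalityI subsetI)
  fix v :: "(real^'n^'n) \<times> (real^'n^'n)"
  assume "v \<in> tangent_space (carrier BO) \<one>\<^bsub>BO\<^esub>"
  then obtain e \<gamma> where "e > 0" and in_BO: "\<gamma> ` {-e<..<e} \<subseteq> BO_set"
    and \<gamma>0: "\<gamma> 0 = (mat 1, mat 1)" and deriv: "(\<gamma> has_vector_derivative v) (at 0)"
    by (auto simp: tangent_space_def carrier_BO one_BO)
  have "((\<lambda>t. fst (\<gamma> t) ** snd (\<gamma> t)) has_vector_derivative snd v + fst v) (at 0)"
    using has_vector_derivative_matrix_mult[OF
        bounded_linear.has_vector_derivative[OF bounded_linear_fst deriv]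
        bounded_linear.has_vector_derivative[OF bounded_linear_snd deriv]]
    by (simp add: \<gamma>0)
  moreover have "((\<lambda>t. fst (\<gamma> t) ** snd (\<gamma> t)) has_vector_derivative 0) (at 0)"
  proof (rule has_vector_derivative_transform_within_open)
    show "((\<lambda>_. mat 1 :: real^'n^'n) has_vector_derivative 0) (at 0)"
      by simp
    show "mat 1 = fst (\<gamma> t) ** snd (\<gamma> t)" if "t \<in> {-e<..<e}" for t
    proof -
      have "\<gamma> t \<in> BO_set"
        using in_BO that by blast
      then show ?thesis
        using BO_set_iff[of "fst (\<gamma> t)" "snd (\<gamma> t)"] by simp
    qed
  qed (use \<open>e > 0\<close> in auto)
  ultimately have "snd v + fst v = 0"
    by (rule vector_derivative_unique_at)
  then have "v = (fst v, - fst v)"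
    by (simp add: prod_eq_iff eq_neg_iff_add_eq_0)
  then show "v \<in> {(X, - X) | X. True}"
    by blast
next
  fix v :: "(real^'n^'n) \<times> (real^'n^'n)"
  assume "v \<in> {(X, - X) | X. True}"
  then obtain X where "v = (X, - X)"
    by blast
  then show "v \<in> tangent_space (carrier BO) \<one>\<^bsub>BO\<^esub>"
    unfolding tangent_space_def
    using smooth_BO_curve[of _ X] BO_curve_in_carrier[of X] BO_curve_0[of X]
      BO_curve_has_vector_derivative[of X]
    by (auto intro!: exI[of _ 1] exI[of _ "BO_curve X"])
qed

theorem theorem2:
  shows "tangent_space (carrier BO) \<one>\<^bsub>BO\<^esub> = {(X, - X) | X :: real^'n^'n. True} \<and>
         (\<forall>X :: real^'n^'n. lie_exp BO (X, - X) = (mat_exp X, mat_exp (- X)))"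
  using tangent_space_BO lie_exp_BO by blast

end
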